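(* Let $X_0,X_1,\ldots$ be a (possibly non-stationary) stochastic process on $(\mathcal Y,\mathcal B,\mathbb P)$ and let $(u_{n,i})$ be a real-valued boundary, as in the context. Suppose that, for some $\tau>0$, as $n\to\infty$, $$\bar F_{n,\max}=\max\{\bar F_i(u_{n,i}):0\le i\le n-1\}\to 0\qquad\text{and}\qquad F_n^*=\sum_{i=0}^{n-1}\bar F_i(u_{n,i})\to\tau .$$ Suppose that there exists $q\in\mathbb N_0$ with $q=\min\{j\in\mathbb N_0:\lim_{n\to\infty}\min_{i\le n}R^{(j)}_{n,i}=\infty\}$. Assume that condition $D_q(u_{n,i})$ holds, with associated sequence $(t_n^* )_n$; that condition $D'_q(u_{n,i})$ holds, with associated sequence $(k_n)_n$ (and the corresponding blocks); and that there is $0\le\theta\le 1$ such that $$\lim_{n\to\infty}\ \max_{i=1,\ldots,k_n}\left|\theta k_n\sum_{j=\mathcal L_{n,i-1}}^{\mathcal L_{n,i}-1}\bar F_j(u_{n,j})-k_n\sum_{j=\mathcal L_{n,i-1}}^{\mathcal L_{n,i}-1}\mathbb P\big(A^{(q)}_{n,j}\big)\right|=0 .$$ Then $$\lim_{n\to\infty}\mathbb P\big(X_0\le u_{n,0},\,X_1\le u_{n,1},\ldots,X_{n-1}\le u_{n,n-1}\big)=e^{-\theta\tau}.$$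
   Context: Process. $(\mathcal Y,\mathcal B,\mathbb P)$ is a probability space, where $\mathcal Y$ is a sequence space with a natural product structure, each realisation of the process corresponding to a unique element of $\mathcal Y$, and $\mathcal B$ is the corresponding product $\sigma$-algebra; $\mathcal T:\mathcal Y\to\mathcal Y$ is measurable and $X_{i-1}\circ\mathcal T=X_i$ for all $i\in\mathbb N$. $\mathbb P$ need not be $\mathcal T$-invariant. $F_i(x)=\mathbb P(X_i\le x)$, $\bar F_i=1-F_i$, $u_{F_i}=\sup\{x:F_i(x)<1\}$, and it is assumed that $\lim_{h\downarrow0}F_i(u_{F_i}-h)=1$ for all $i$. The boundary is an array of reals $u_{n,i}$, $n\in\mathbb N$, $i\in\mathbb N_0$. Events. For $j\in\mathbb N$, $A^{(j)}_{n,i}=\{X_i>u_{n,i},\,X_{i+1}\le u_{n,i+1},\ldots,X_{i+j}\le u_{n,i+j}\}$, and $A^{(0)}_{n,i}=\{X_i>u_{n,i}\}$. $\mathbb A^{(j)}_n=(A^{(j)}_{n,0},A^{(j)}_{n,1},\ldots)$. For a sequence of events $\mathbb A=(A_0,A_1,\ldots)$ and $s,\ell\in\mathbb N_0$, $\mathscr W_{s,\ell}(\mathbb A)=\bigcap_{i=s}^{s+\ell-1}A_i^c$. $R^{(j)}_{n,i}=\min\{r\in\mathbb N:A^{(j)}_{n,i}\cap A^{(j)}_{n,i+r}\ne\emptyset\}$ (with $\min\emptyset=\infty$). Condition $D_q(u_{n,i})$: for every $\ell,t,n\in\mathbb N$ and every $i\in\mathbb N_0$, $$\big|\mathbb P(A^{(q)}_{n,i}\cap\mathscr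 W_{i+t,\ell}(\mathbb A^{(q)}_n))-\mathbb P(A^{(q)}_{n,i})\,\mathbb P(\mathscr W_{i+t,\ell}(\mathbb A^{(q)}_n))\big|\le\gamma_i(q,n,t),$$ where $\gamma_i(q,n,t)$ is decreasing in $t$ for each $n$ and each $i$, and there is a sequence $(t_n^* )_{n\in\mathbb N}$ of positive integers such that $t_n^*\bar F_{n,\max}\to0$ and $\sum_{i=0}^{n-1}\gamma_i(q,n,t_n^* )\to0$ as $n\to\infty$. Blocks. Let $(k_n)$ be a sequence of positive integers such that $k_n\to\infty$ and $k_nt_n^*\bar F_{n,\max}\to0$. Set $\mathcal L_{n,0}=0$ and $\mathcal L_{n,i}=\sum_{j=1}^i\ell_{n,j}$, where $\ell_{n,1},\ldots,\ell_{n,k_n}$ are defined inductively: $\ell_{n,i}$ is the largest integer (with $\mathcal L_{n,i-1}+\ell_{n,i}\le n$) such that $$\sum_{j=\mathcal L_{n,i-1}}^{\mathcal L_{n,i-1}+\ell_{n,i}-1}\bar F_j(u_{n,j})\le\frac{F_n^*}{k_n}.$$ Condition $D'_q(u_{n,i})$: there exists a sequence $(k_n)_n$ of positive integers with $k_n\to\infty$ and $k_nt_n^*\bar F_{n,\max}\to0$, where $(t_n^* )$ is the sequence given by $D_q(u_{n,i})$, such that, for the block lengths $\ell_{n,i}$ and endpoints $\mathcal L_{n,i}$ constructed from this $(k_n)$ (that is, $\mathcal L_{n,0}=0$, $\mathcal L_{n,i}=\sum_{j=1}^i\ell_{n,j}$, and $\ell_{n,i}$ is the largest integer with $\mathcal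 L_{n,i-1}+\ell_{n,i}\le n$ and $\sum_{j=\mathcal L_{n,i-1}}^{\mathcal L_{n,i-1}+\ell_{n,i}-1}\bar F_j(u_{n,j})\le F_n^*/k_n$), $$\lim_{n\to\infty}\sum_{i=1}^{k_n}\sum_{j=0}^{\ell_{n,i}-1}\sum_{r=j+1}^{\ell_{n,i}-1}\mathbb P\big(A^{(q)}_{n,\mathcal L_{n,i-1}+j}\cap A^{(q)}_{n,\mathcal L_{n,i-1}+r}\big)=0.$$ *)

theory Defs
  imports "HOL-Probability.Probability"
begin

text \<open>
  The distribution function \<open>F\<^sub>i\<close>.  It takes an extended real argument, so that
  \<open>F\<^sub>i (u - h)\<close> makes sense when the right endpoint \<open>u\<close> is \<open>\<infinity>\<close>;
  in that case \<open>F\<^sub>i (\<infinity> - h) = F\<^sub>i \<infinity> = 1\<close>.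
\<close>

definition dist_fun :: "'a measure \<Rightarrow> (nat \<Rightarrow> 'a \<Rightarrow> real) \<Rightarrow> nat \<Rightarrow> ereal \<Rightarrow> real" where
  "dist_fun M X i x = measure M {y \<in> space M. ereal (X i y) \<le> x}"

definition surv_fun :: "'a measure \<Rightarrow> (nat \<Rightarrow> 'a \<Rightarrow> real) \<Rightarrow> nat \<Rightarrow> real \<Rightarrow> real" where
  "surv_fun M X i x = 1 - dist_fun M X i (ereal x)"

definition right_endpoint :: "'a measure \<Rightarrow> (nat \<Rightarrow> 'a \<Rightarrow> real) \<Rightarrow> nat \<Rightarrow> ereal" where
  "right_endpoint M X i = Sup {ereal x | x. dist_fun M X i (ereal x) < 1}"

text \<open>
  The sample space \<open>\<Y> = space M\<close> is a set of sequences with entries in a measurable space \<open>S\<close>,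
  equipped with the trace of the product sigma-algebra; it need not consist of all sequences.
  By \<open>realisation_unique\<close>, a realisation \<open>(X\<^sub>0(y), X\<^sub>1(y), \<dots>)\<close> determines the element \<open>y\<close> of
  \<open>\<Y>\<close> it comes from.  The measure is not assumed to be invariant under \<open>T\<close>.
\<close>

locale sequence_process = prob_space M
  for M :: "(nat \<Rightarrow> 's) measure" +
  fixes S :: "'s measure"
    and T :: "(nat \<Rightarrow> 's) \<Rightarrow> (nat \<Rightarrow> 's)"
    and X :: "nat \<Rightarrow> (nat \<Rightarrow> 's) \<Rightarrow> real"
  assumes space_sequences: "space M \<subseteq> space (PiM UNIV (\<lambda>_. S))"
    and sets_product: "sets M = sets (restrict_space (PiM UNIV (\<lambda>_. S)) (space M))"
    and random_variable_X: "\<And>i. X i \<in> borel_measurable M"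
    and realisation_unique: "inj_on (\<lambda>y i. X i y) (space M)"
    and measurable_T: "T \<in> measurable M M"
    and X_T: "\<And>i y. y \<in> space M \<Longrightarrow> X i (T y) = X (Suc i) y"
    and endpoint_continuity:
      "\<And>i. ((\<lambda>h. dist_fun M X i (right_endpoint M X i - ereal h)) \<longlongrightarrow> 1) (at_right 0)"

text \<open>
  The boundary is \<open>u n i\<close>.  Throughout, the index \<open>n\<close> is meant to be positive; the values of the
  following functions at \<open>n = 0\<close> are irrelevant.
\<close>

definition Fbar_max :: "'a measure \<Rightarrow> (nat \<Rightarrow> 'a \<Rightarrow> real) \<Rightarrow> (nat \<Rightarrow> nat \<Rightarrow> real) \<Rightarrow> nat \<Rightarrow> real" where
  "Fbar_max M X u n = Max ((\<lambda>i. surv_fun M X i (u n i)) ` {0..<n})"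

definition Fstar :: "'a measure \<Rightarrow> (nat \<Rightarrow> 'a \<Rightarrow> real) \<Rightarrow> (nat \<Rightarrow> nat \<Rightarrow> real) \<Rightarrow> nat \<Rightarrow> real" where
  "Fstar M X u n = (\<Sum>i = 0..<n. surv_fun M X i (u n i))"

definition A_event ::
  "'a measure \<Rightarrow> (nat \<Rightarrow> 'a \<Rightarrow> real) \<Rightarrow> (nat \<Rightarrow> nat \<Rightarrow> real) \<Rightarrow> nat \<Rightarrow> nat \<Rightarrow> nat \<Rightarrow> 'a set" where
  "A_event M X u j n i =
     {y \<in> space M. X i y > u n i \<and> (\<forall>m\<in>{1..j}. X (i + m) y \<le> u n (i + m))}"

definition W_event :: "'a measure \<Rightarrow> nat \<Rightarrow> nat \<Rightarrow> (nat \<Rightarrow> 'a set) \<Rightarrow> 'a set" where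
  "W_event M s l A = space M \<inter> (\<Inter>i\<in>{s..<s + l}. space M - A i)"

text \<open>The infimum of the empty set in \<^typ>\<open>enat\<close> is \<open>\<infinity>\<close>.\<close>

definition first_return ::
  "'a measure \<Rightarrow> (nat \<Rightarrow> 'a \<Rightarrow> real) \<Rightarrow> (nat \<Rightarrow> nat \<Rightarrow> real) \<Rightarrow> nat \<Rightarrow> nat \<Rightarrow> nat \<Rightarrow> enat" where
  "first_return M X u j n i =
     Inf {enat r | r. r \<ge> 1 \<and> A_event M X u j n i \<inter> A_event M X u j n (i + r) \<noteq> {}}"

definition returns_diverge ::
  "'a measure \<Rightarrow> (nat \<Rightarrow> 'a \<Rightarrow> real) \<Rightarrow> (nat \<Rightarrow> nat \<Rightarrow> real) \<Rightarrow> nat \<Rightarrow> bool" where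
  "returns_diverge M X u j \<longleftrightarrow>
     (\<lambda>n. Min ((\<lambda>i. first_return M X u j n i) ` {0..n})) \<longlonglongrightarrow> \<infinity>"

text \<open>``Decreasing in \<open>t\<close>'' is read as non-increasing.\<close>

definition cond_D ::
  "'a measure \<Rightarrow> (nat \<Rightarrow> 'a \<Rightarrow> real) \<Rightarrow> (nat \<Rightarrow> nat \<Rightarrow> real) \<Rightarrow> nat \<Rightarrow> (nat \<Rightarrow> nat) \<Rightarrow> bool" where
  "cond_D M X u q tstar \<longleftrightarrow>
     (\<exists>\<gamma> :: nat \<Rightarrow> nat \<Rightarrow> nat \<Rightarrow> real.
        (\<forall>l\<ge>1. \<forall>t\<ge>1. \<forall>n\<ge>1. \<forall>i.
           \<bar>measure M (A_event M X u q n i \<inter> W_event M (i + t) l (A_event M X u q n))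
            - measure M (A_event M X u q n i)
              * measure M (W_event M (i + t) l (A_event M X u q n))\<bar> \<le> \<gamma> i n t) \<and>
        (\<forall>n\<ge>1. \<forall>i. \<forall>t\<ge>1. \<forall>t'\<ge>t. \<gamma> i n t' \<le> \<gamma> i n t) \<and>
        (\<forall>n\<ge>1. tstar n > 0) \<and>
        (\<lambda>n. real (tstar n) * Fbar_max M X u n) \<longlonglongrightarrow> 0 \<and>
        (\<lambda>n. \<Sum>i = 0..<n. \<gamma> i n (tstar n)) \<longlonglongrightarrow> 0)"

text \<open>
  \<open>block_length_from M X u k n s\<close> is the length of the block that starts at time \<open>s\<close>; the empty
  block always qualifies, so it is enough to consider natural numbers.
\<close>

definition block_length_from ::
  "'a measure \<Rightarrow> (nat \<Rightarrow> 'a \<Rightarrow> real) \<Rightarrow> (nat \<Rightarrow> nat \<Rightarrow> real) \<Rightarrow> (nat \<Rightarrow> nat) \<Rightarrow> nat \<Rightarrow> nat \<Rightarrow> nat" where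
  "block_length_from M X u k n s =
     (GREATEST l. s + l \<le> n \<and>
        (\<Sum>j = s..<s + l. surv_fun M X j (u n j)) \<le> Fstar M X u n / real (k n))"

primrec block_end ::
  "'a measure \<Rightarrow> (nat \<Rightarrow> 'a \<Rightarrow> real) \<Rightarrow> (nat \<Rightarrow> nat \<Rightarrow> real) \<Rightarrow> (nat \<Rightarrow> nat) \<Rightarrow> nat \<Rightarrow> nat \<Rightarrow> nat" where
  "block_end M X u k n 0 = 0"
| "block_end M X u k n (Suc i) =
     block_end M X u k n i + block_length_from M X u k n (block_end M X u k n i)"

text \<open>The blocks are numbered from \<open>1\<close>.\<close>

definition block_length ::
  "'a measure \<Rightarrow> (nat \<Rightarrow> 'a \<Rightarrow> real) \<Rightarrow> (nat \<Rightarrow> nat \<Rightarrow> real) \<Rightarrow> (nat \<Rightarrow> nat) \<Rightarrow> nat \<Rightarrow> nat \<Rightarrow> nat" where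
  "block_length M X u k n i = block_length_from M X u k n (block_end M X u k n (i - 1))"

lemma block_end_eq_sum: "block_end M X u k n i = (\<Sum>j = 1..i. block_length M X u k n j)"
  by (induction i) (simp_all add: block_length_def)

definition cond_D' ::
  "'a measure \<Rightarrow> (nat \<Rightarrow> 'a \<Rightarrow> real) \<Rightarrow> (nat \<Rightarrow> nat \<Rightarrow> real) \<Rightarrow> nat \<Rightarrow> (nat \<Rightarrow> nat) \<Rightarrow> (nat \<Rightarrow> nat) \<Rightarrow> bool" where
  "cond_D' M X u q tstar k \<longleftrightarrow>
     (\<forall>n\<ge>1. k n > 0) \<and>
     filterlim k at_top sequentially \<and>
     (\<lambda>n. real (k n) * real (tstar n) * Fbar_max M X u n) \<longlonglongrightarrow> 0 \<and>
     (\<lambda>n. \<Sum>i = 1..k n. \<Sum>j = 0..<block_length M X u k n i.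
            \<Sum>r = j + 1..<block_length M X u k n i.
              measure M (A_event M X u q n (block_end M X u k n (i - 1) + j)
                         \<inter> A_event M X u q n (block_end M X u k n (i - 1) + r))) \<longlonglongrightarrow> 0"

end

theory Submission
  imports Defs
begin

text \<open>
  Up to a probability of order \<open>q Fbar_max\<close>, having no exceedance before time \<open>n\<close> means that none of
  the events \<open>A\<^sub>j\<close>, \<open>j < n\<close>, occurs.  Let \<open>x\<^sub>i\<close> be the probability that none of them occurs from
  the start of block \<open>i\<close> to the end of the last block, and \<open>a\<^sub>i\<close> the sum of their probabilities over
  block \<open>i\<close>.  Bonferroni's inequalities (with \<open>D'\<close> controlling the pairs) and the mixing condition
  \<open>D\<close> give \<open>x\<^sub>i \<approx> (1 - a\<^sub>i) x\<^sub>i\<^sub>+\<^sub>1 \<approx> exp (- a\<^sub>i) x\<^sub>i\<^sub>+\<^sub>1\<close>; no gaps between the blocks are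
  needed, because the fewer than \<open>t*\<close> indices of a block that are too close to its end for \<open>D\<close> to
  apply contribute at most \<open>t* Fbar_max\<close>.  The sum of the errors over the blocks tends to 0, so
  \<open>x\<^sub>0 \<approx> exp (- \<Sum>i. a\<^sub>i)\<close>, and \<open>\<Sum>i. a\<^sub>i\<close> tends to \<open>\<theta> \<tau>\<close>.
\<close>

section \<open>Elementary estimates for real sequences\<close>

lemma exp_minus_le_quadratic:
  fixes a :: real
  assumes "0 \<le> a"
  shows "exp (- a) \<le> 1 - a + a\<^sup>2"
proof -
  have "exp (- a) \<le> 1 / (1 + a)"
    using exp_ge_add_one_self[of a] assms by (simp add: exp_minus field_simps)
  also have "\<dots> \<le> 1 - a + a\<^sup>2"
  proof -
    have "(1 - a + a\<^sup>2) * (1 + a) = 1 + a ^ 3"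
      by (simp add: algebra_simps power2_eq_square power3_eq_cube)
    then show ?thesis
      using assms by (simp add: pos_divide_le_eq)
  qed
  finally show ?thesis .
qed

text \<open>Unrolling the recursion multiplies the error of step \<open>i\<close> by
  \<open>exp\<close> of minus the preceding \<open>a\<close>'s. This factor is at most 1 because the
  \<open>a\<close>'s are nonnegative, so errors add up without amplification.\<close>

lemma exp_recursion_error:
  fixes x a e :: "nat \<Rightarrow> real"
  assumes "\<And>i. i < m \<Longrightarrow> \<bar>x i - exp (- a i) * x (Suc i)\<bar> \<le> e i"
    and "\<And>i. i < m \<Longrightarrow> 0 \<le> a i"
  shows "\<bar>x 0 - exp (- (\<Sum>i<m. a i)) * x m\<bar> \<le> (\<Sum>i<m. e i)"
  using assms
proof (induction m)
  case 0
  then show ?case by simp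
next
  case (Suc m)
  define c where "c = exp (- (\<Sum>i<m. a i))"
  have c: "0 \<le> c" "c \<le> 1"
    using Suc.prems(2) by (auto simp: c_def intro!: sum_nonneg)
  have IH: "\<bar>x 0 - c * x m\<bar> \<le> (\<Sum>i<m. e i)"
    unfolding c_def using Suc.prems by (intro Suc.IH) auto
  have "\<bar>c * (x m - exp (- a m) * x (Suc m))\<bar> \<le> 1 * e m"
    unfolding abs_mult using c Suc.prems(1)[of m] by (intro mult_mono) auto
  moreover have "exp (- (\<Sum>i<Suc m. a i)) = c * exp (- a m)"
    by (simp add: c_def exp_add[symmetric])
  ultimately show ?case
    using IH by (simp add: algebra_simps)
qed

lemma sum_consecutive_blocks:
  fixes b :: "nat \<Rightarrow> nat" and f :: "nat \<Rightarrow> 'a::comm_monoid_add"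
  assumes "mono b"
  shows "(\<Sum>i<m. \<Sum>j = b i..<b (Suc i). f j) = (\<Sum>j = b 0..<b m. f j)"
proof (induction m)
  case 0
  then show ?case by simp
next
  case (Suc m)
  have "b 0 \<le> b m" "b m \<le> b (Suc m)"
    using assms by (auto intro: monoD)
  then show ?case
    using Suc by (simp add: sum.atLeastLessThan_concat)
qed

section \<open>Finite block estimates for an arbitrary sequence of events\<close>

context prob_space
begin

text \<open>Induction on \<open>e\<close>: adjoining \<open>A e\<close> to the union gains
  \<open>prob (A e)\<close> minus its overlap with the earlier events, and the union bound dominates
  this overlap by exactly the new pairs, those with \<open>r = e\<close>.\<close>

lemma bonferroni_lower:
  fixes A :: "nat \<Rightarrow> 'a set"
  assumes A: "\<And>j. A j \<in> events"
  shows "(\<Sum>j = s..<e. prob (A j)) - (\<Sum>j = s..<e. \<Sum>r = j + 1..<e. prob (A j \<inter> A r))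
    \<le> prob (\<Union>j\<in>{s..<e}. A j)"
proof (induction e)
  case 0
  then show ?case by simp
next
  case (Suc e)
  show ?case
  proof (cases "s \<le> e")
    case True
    let ?B = "\<Union>j\<in>{s..<e}. A j"
    have "prob (A e \<inter> ?B) \<le> (\<Sum>j = s..<e. prob (A j \<inter> A e))"
    proof -
      have "A e \<inter> ?B = (\<Union>j\<in>{s..<e}. A j \<inter> A e)" by auto
      then show ?thesis
        using A finite_measure_subadditive_finite[of "{s..<e}" "\<lambda>j. A j \<inter> A e"]
        by (simp add: image_subset_iff)
    qed
    moreover have "prob (\<Union>j\<in>{s..<Suc e}. A j) = prob (A e) + prob ?B - prob (A e \<inter> ?B)"
    proof -
      have "(\<Union>j\<in>{s..<Suc e}. A j) = A e \<union> ?B"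
        using True by (auto simp: atLeastLessThanSuc)
      then show ?thesis
        using A by (simp add: measure_Un3 fmeasurable_eq_sets)
    qed
    moreover have "(\<Sum>j = s..<Suc e. \<Sum>r = j + 1..<Suc e. prob (A j \<inter> A r))
        = (\<Sum>j = s..<e. \<Sum>r = j + 1..<e. prob (A j \<inter> A r)) + (\<Sum>j = s..<e. prob (A j \<inter> A e))"
      using True by (simp add: sum.distrib)
    ultimately show ?thesis
      using Suc True by simp
  next
    case False
    then show ?thesis by simp
  qed
qed

lemma W_event_measurable:
  assumes "\<And>j. A j \<in> events"
  shows "W_event M s l A \<in> events"
  \<comment> \<open>For \<open>l = 0\<close> the intersection is over an empty index set, hence
    \<open>UNIV\<close>; the factor \<open>space M\<close> in the definition makes it an
    event.\<close>
  unfolding W_event_def using assms by (cases "l = 0") (auto intro!: sets.Int sets.finite_INT)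

text \<open>All windows share the right end \<open>d\<close>, so \<open>W s\<close> arises from
  \<open>W e\<close> by removing the sets \<open>A j \<inter> W e\<close> of one block. The union
  bound and Bonferroni's inequality enclose the removed probability; the pairs are enlarged by
  dropping \<open>W e\<close>, and the first sum is the cost of factorising.\<close>

lemma block_step:
  fixes A :: "nat \<Rightarrow> 'a set"
  assumes A: "\<And>j. A j \<in> events" and "s \<le> e" "e \<le> d"
  defines "W \<equiv> \<lambda>i. W_event M i (d - i) A"
  shows "\<bar>prob (W s) - (1 - (\<Sum>j = s..<e. prob (A j))) * prob (W e)\<bar>
    \<le> (\<Sum>j = s..<e. \<bar>prob (A j \<inter> W e) - prob (A j) * prob (W e)\<bar>)
      + (\<Sum>j = s..<e. \<Sum>r = j + 1..<e. prob (A j \<inter> A r))"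
proof -
  have W: "W i \<in> events" for i
    unfolding W_def by (rule W_event_measurable[OF A])
  let ?B = "\<Union>j\<in>{s..<e}. A j \<inter> W e"
  have ranges: "{s..<d} = {s..<e} \<union> {e..<d}"
    using assms by auto
  have "W s = W e - ?B"
  proof -
    have "W s = space M \<inter> (\<Inter>i\<in>{s..<d}. space M - A i)" "W e = space M \<inter> (\<Inter>i\<in>{e..<d}. space M - A i)"
      unfolding W_def W_event_def using \<open>s \<le> e\<close> \<open>e \<le> d\<close> by simp_all
    then show ?thesis
      unfolding ranges by blast
  qed
  then have split: "prob (W s) = prob (W e) - prob ?B"
    using A W by (auto intro!: finite_measure_Diff)
  have upper: "prob ?B \<le> (\<Sum>j = s..<e. prob (A j \<inter> W e))"
    using A W by (intro finite_measure_subadditive_finite) auto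
  have "(\<Sum>j = s..<e. \<Sum>r = j + 1..<e. prob ((A j \<inter> W e) \<inter> (A r \<inter> W e)))
      \<le> (\<Sum>j = s..<e. \<Sum>r = j + 1..<e. prob (A j \<inter> A r))"
    using A by (intro sum_mono finite_measure_mono) auto
  then have lower: "(\<Sum>j = s..<e. prob (A j \<inter> W e))
      - (\<Sum>j = s..<e. \<Sum>r = j + 1..<e. prob (A j \<inter> A r)) \<le> prob ?B"
    using bonferroni_lower[of "\<lambda>j. A j \<inter> W e" s e] A W by auto
  have "\<bar>(\<Sum>j = s..<e. prob (A j \<inter> W e)) - (\<Sum>j = s..<e. prob (A j)) * prob (W e)\<bar>
      \<le> (\<Sum>j = s..<e. \<bar>prob (A j \<inter> W e) - prob (A j) * prob (W e)\<bar>)"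
    by (simp add: sum_distrib_right sum_subtractf[symmetric] sum_abs)
  moreover have "0 \<le> (\<Sum>j = s..<e. \<Sum>r = j + 1..<e. prob (A j \<inter> A r))"
    by (intro sum_nonneg) auto
  ultimately show ?thesis
    using split upper lower by (simp add: algebra_simps)
qed

text \<open>Where the gap to \<open>e\<close> is shorter than \<open>t\<close>, mixing says nothing,
  but both terms of the difference lie between 0 and \<open>prob (A j)\<close>, so
  \<open>\<phi>\<close> bounds it. There are at most \<open>t\<close> such indices.\<close>

lemma mixing_error_le:
  fixes A :: "nat \<Rightarrow> 'a set" and t :: nat and \<gamma> :: "nat \<Rightarrow> real" and \<phi> :: real
  assumes A: "\<And>j. A j \<in> events" and W: "W \<in> events"
    and small: "\<And>j. j \<in> {s..<e} \<Longrightarrow> prob (A j) \<le> \<phi>"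
    and mixing: "\<And>j. j \<in> {s..<e} \<Longrightarrow> j + t \<le> e \<Longrightarrow> \<bar>prob (A j \<inter> W) - prob (A j) * prob W\<bar> \<le> \<gamma> j"
    and nonneg: "\<And>j. j \<in> {s..<e} \<Longrightarrow> 0 \<le> \<gamma> j" and "0 \<le> \<phi>"
  shows "(\<Sum>j = s..<e. \<bar>prob (A j \<inter> W) - prob (A j) * prob W\<bar>) \<le> (\<Sum>j = s..<e. \<gamma> j) + t * \<phi>"
proof -
  have trivial: "\<bar>prob (A j \<inter> W) - prob (A j) * prob W\<bar> \<le> prob (A j)" for j
  proof -
    have "prob (A j \<inter> W) \<le> prob (A j)"
      using A by (intro finite_measure_mono) auto
    moreover have "prob (A j) * prob W \<le> prob (A j)"
      by (simp add: mult_left_le)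
    ultimately show ?thesis
      using measure_nonneg[of M "A j \<inter> W"] 
        mult_nonneg_nonneg[OF measure_nonneg measure_nonneg, of M "A j" M W]
      by linarith
  qed
  have "(\<Sum>j = s..<e. \<bar>prob (A j \<inter> W) - prob (A j) * prob W\<bar>)
      \<le> (\<Sum>j = s..<e. \<gamma> j + (if e < j + t then \<phi> else 0))"
  proof (rule sum_mono)
    fix j assume j: "j \<in> {s..<e}"
    show "\<bar>prob (A j \<inter> W) - prob (A j) * prob W\<bar> \<le> \<gamma> j + (if e < j + t then \<phi> else 0)"
      using mixing[OF j] small[OF j] nonneg[OF j] trivial[of j] by (cases "e < j + t") auto
  qed
  also have "\<dots> = (\<Sum>j = s..<e. \<gamma> j) + card {j \<in> {s..<e}. e < j + t} * \<phi>"
    by (simp add: sum.distrib sum.inter_filter[symmetric])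
  also have "\<dots> \<le> (\<Sum>j = s..<e. \<gamma> j) + t * \<phi>"
  proof -
    have "card {j \<in> {s..<e}. e < j + t} \<le> card {e - t..<e}"
      by (intro card_mono) auto
    then show ?thesis
      using \<open>0 \<le> \<phi>\<close> by (auto intro!: mult_right_mono)
  qed
  finally show ?thesis .
qed

text \<open>This is the whole argument for one fixed \<open>n\<close>, with explicit errors: mixing,
  indices too close to a block end, pairs inside a block, and finally the squares from replacing
  \<open>1 - a i\<close> by \<open>exp (- a i)\<close>.\<close>

lemma block_approximation:
  fixes A :: "nat \<Rightarrow> 'a set" and t :: nat and b :: "nat \<Rightarrow> nat" and \<gamma> :: "nat \<Rightarrow> real" and \<phi> :: real
  assumes A: "\<And>j. A j \<in> events" and b: "mono b" "b 0 = 0"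
    and small: "\<And>j. j < b m \<Longrightarrow> prob (A j) \<le> \<phi>"
    and mixing: "\<And>j e. e \<le> b m \<Longrightarrow> j + t \<le> e \<Longrightarrow>
      \<bar>prob (A j \<inter> W_event M e (b m - e) A) - prob (A j) * prob (W_event M e (b m - e) A)\<bar> \<le> \<gamma> j"
    and nonneg: "\<And>j. 0 \<le> \<gamma> j" and "0 \<le> \<phi>"
  shows "\<bar>prob (W_event M 0 (b m) A) - exp (- (\<Sum>j = 0..<b m. prob (A j)))\<bar>
    \<le> (\<Sum>j = 0..<b m. \<gamma> j) + m * (t * \<phi>)
      + (\<Sum>i<m. \<Sum>j = b i..<b (Suc i). \<Sum>r = j + 1..<b (Suc i). prob (A j \<inter> A r))
      + (\<Sum>i<m. (\<Sum>j = b i..<b (Suc i). prob (A j))\<^sup>2)"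
proof -
  define W where "W = (\<lambda>i. W_event M i (b m - i) A)"
  define a where "a i = (\<Sum>j = b i..<b (Suc i). prob (A j))" for i
  define p where "p i = (\<Sum>j = b i..<b (Suc i). \<Sum>r = j + 1..<b (Suc i). prob (A j \<inter> A r))" for i
  have a_nonneg: "0 \<le> a i" for i
    unfolding a_def by (intro sum_nonneg) auto
  have "\<bar>prob (W (b i)) - exp (- a i) * prob (W (b (Suc i)))\<bar>
      \<le> (\<Sum>j = b i..<b (Suc i). \<gamma> j) + t * \<phi> + p i + (a i)\<^sup>2" if "i < m" for i
  proof -
    let ?w = "prob (W (b (Suc i)))"
    have le: "b i \<le> b (Suc i)" "b (Suc i) \<le> b m"
      using b(1) that by (auto intro: monoD)
    have "\<bar>prob (W (b i)) - (1 - a i) * ?w\<bar>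
        \<le> (\<Sum>j = b i..<b (Suc i). \<bar>prob (A j \<inter> W (b (Suc i))) - prob (A j) * ?w\<bar>) + p i"
      using block_step[OF A le] by (simp add: a_def p_def W_def)
    moreover have "(\<Sum>j = b i..<b (Suc i). \<bar>prob (A j \<inter> W (b (Suc i))) - prob (A j) * ?w\<bar>)
        \<le> (\<Sum>j = b i..<b (Suc i). \<gamma> j) + t * \<phi>"
    proof (rule mixing_error_le)
      show "W (b (Suc i)) \<in> events"
        unfolding W_def by (rule W_event_measurable[OF A])
      show "\<bar>prob (A j \<inter> W (b (Suc i))) - prob (A j) * ?w\<bar> \<le> \<gamma> j" if "j + t \<le> b (Suc i)" for j
        unfolding W_def using mixing le(2) that by blast
    qed (use A small nonneg le \<open>0 \<le> \<phi>\<close> in auto)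
    \<comment> \<open>\<open>exp (- a i)\<close> lies between \<open>1 - a i\<close> and
      \<open>1 - a i + (a i)\<^sup>2\<close>.\<close>
    moreover have "\<bar>((1 - a i) - exp (- a i)) * ?w\<bar> \<le> (a i)\<^sup>2 * 1"
      unfolding abs_mult
      using exp_minus_le_quadratic[OF a_nonneg[of i]] exp_ge_add_one_self[of "- a i"]
      by (intro mult_mono) auto
    ultimately show ?thesis
      by (simp add: algebra_simps)
  qed
  from exp_recursion_error[of m "\<lambda>i. prob (W (b i))", OF this a_nonneg]
  have "\<bar>prob (W (b 0)) - exp (- (\<Sum>i<m. a i)) * prob (W (b m))\<bar>
      \<le> (\<Sum>i<m. (\<Sum>j = b i..<b (Suc i). \<gamma> j) + t * \<phi> + p i + (a i)\<^sup>2)"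
    by blast
  \<comment> \<open>The window after the last block is empty, so the recursion terminates in the
    value 1.\<close>
  moreover have "W (b m) = space M"
    by (simp add: W_def W_event_def)
  moreover have "(\<Sum>i<m. a i) = (\<Sum>j = 0..<b m. prob (A j))"
    unfolding a_def sum_consecutive_blocks[OF b(1)] b(2) ..
  moreover have "(\<Sum>i<m. \<Sum>j = b i..<b (Suc i). \<gamma> j) = (\<Sum>j = 0..<b m. \<gamma> j)"
    unfolding sum_consecutive_blocks[OF b(1)] b(2) ..
  ultimately show ?thesis
    by (simp add: sum.distrib b(2) prob_space W_def a_def p_def)
qed

end

section \<open>Exceedances of the boundary and the blocks of the process\<close>

context sequence_process
begin

lemma exceedance_measurable: "{y \<in> space M. c < X i y} \<in> events"
  using random_variable_X[of i] by measurable

lemma A_event_measurable: "A_event M X u j n i \<in> events"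
  unfolding A_event_def using random_variable_X by measurable

lemma surv_fun_eq: "surv_fun M X i c = prob {y \<in> space M. c < X i y}"
proof -
  have "{y \<in> space M. c < X i y} = space M - {y \<in> space M. X i y \<le> c}"
    by auto
  moreover have "{y \<in> space M. X i y \<le> c} \<in> events"
    using random_variable_X[of i] by measurable
  ultimately show ?thesis
    by (simp add: surv_fun_def dist_fun_def prob_compl)
qed

lemma surv_fun_nonneg: "0 \<le> surv_fun M X i c"
  by (simp add: surv_fun_eq)

lemma prob_A_event_le: "prob (A_event M X u j n i) \<le> surv_fun M X i (u n i)"
  unfolding surv_fun_eq using exceedance_measurable
  by (intro finite_measure_mono) (auto simp: A_event_def)

lemma surv_fun_le_Fbar_max: "i < n \<Longrightarrow> surv_fun M X i (u n i) \<le> Fbar_max M X u n"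
  unfolding Fbar_max_def by (intro Max_ge) auto

lemma Fbar_max_nonneg: "0 < n \<Longrightarrow> 0 \<le> Fbar_max M X u n"
  using surv_fun_nonneg surv_fun_le_Fbar_max order_trans by meson

lemma Fstar_nonneg: "0 \<le> Fstar M X u n"
  unfolding Fstar_def by (intro sum_nonneg surv_fun_nonneg)

lemma sum_surv_fun_le: "e \<le> n \<Longrightarrow> (\<Sum>j = s..<e. surv_fun M X j (u n j)) \<le> real (e - s) * Fbar_max M X u n"
  using sum_bounded_above[of "{s..<e}" "\<lambda>j. surv_fun M X j (u n j)" "Fbar_max M X u n"]
  by (simp add: surv_fun_le_Fbar_max)

text \<open>The last exceedance before \<open>n\<close> realises one of the events \<open>A\<^sub>i\<close>, unless it is among the last
  \<open>q\<close> indices.\<close>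

lemma no_exceedance_approx:
  assumes "0 < n"
  shows "\<bar>prob {y \<in> space M. \<forall>i<n. X i y \<le> u n i} - prob (W_event M 0 n (A_event M X u q n))\<bar>
    \<le> q * Fbar_max M X u n"
proof -
  let ?N = "{y \<in> space M. \<forall>i<n. X i y \<le> u n i}" and ?W = "W_event M 0 n (A_event M X u q n)"
  let ?E = "\<lambda>i. {y \<in> space M. u n i < X i y}"
  have N: "?N \<in> events"
    using random_variable_X by measurable
  have W: "?W \<in> events"
    by (rule W_event_measurable[OF A_event_measurable])
  have "?N \<subseteq> ?W"
    by (auto simp: W_event_def A_event_def not_le)
  have "?W - ?N \<subseteq> (\<Union>i\<in>{n - q..<n}. ?E i)"
  proof
    fix y assume y: "y \<in> ?W - ?N"
    define I where "I = {i. i < n \<and> u n i < X i y}"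
    have fin: "finite I" and "I \<noteq> {}"
      using y by (auto simp: I_def W_event_def not_le)
    define i where "i = Max I"
    have "i \<in> I"
      unfolding i_def using fin \<open>I \<noteq> {}\<close> by (rule Max_in)
    then have i: "i < n" "u n i < X i y"
      by (auto simp: I_def)
    have "y \<in> space M" "y \<notin> A_event M X u q n i"
      using y i(1) by (auto simp: W_event_def)
    \<comment> \<open>As \<open>i\<close> is the last exceedance before \<open>n\<close>, this later
      one has \<open>i + m \<ge> n\<close>; with \<open>m \<le> q\<close> this gives
      \<open>i \<ge> n - q\<close>, where truncated subtraction also covers
      \<open>q > n\<close>.\<close>
    then obtain m where m: "m \<in> {1..q}" "u n (i + m) < X (i + m) y"
      using i(2) by (auto simp: A_event_def not_le)
    have "\<not> i + m < n"
    proof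
      assume "i + m < n"
      then have "i + m \<le> i"
        unfolding i_def using m(2) fin by (intro Max_ge) (auto simp: I_def i_def)
      then show False
        using m(1) by simp
    qed
    then have "i \<in> {n - q..<n}"
      using m(1) i(1) by auto
    then show "y \<in> (\<Union>i\<in>{n - q..<n}. ?E i)"
      using i(2) \<open>y \<in> space M\<close> by blast
  qed
  then have "prob (?W - ?N) \<le> prob (\<Union>i\<in>{n - q..<n}. ?E i)"
    using exceedance_measurable by (intro finite_measure_mono) auto
  also have "\<dots> \<le> (\<Sum>i = n - q..<n. surv_fun M X i (u n i))"
    unfolding surv_fun_eq using exceedance_measurable
    by (intro finite_measure_subadditive_finite) auto
  also have "\<dots> \<le> real (n - (n - q)) * Fbar_max M X u n"
    by (rule sum_surv_fun_le) simp
  also have "\<dots> \<le> q * Fbar_max M X u n"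
    using Fbar_max_nonneg assms by (intro mult_right_mono) auto
  finally show ?thesis
    using finite_measure_Diff[OF W N \<open>?N \<subseteq> ?W\<close>] finite_measure_mono[OF \<open>?N \<subseteq> ?W\<close> W] by simp
qed

text \<open>The blocks may stop before \<open>n\<close>. Points lost when the window grows from
  \<open>d\<close> to \<open>n\<close> lie in some \<open>A j\<close> with
  \<open>d \<le> j < n\<close>, so the union bound applies.\<close>

lemma prob_W_event_truncate:
  assumes "d \<le> n"
  shows "\<bar>prob (W_event M 0 n (A_event M X u q n)) - prob (W_event M 0 d (A_event M X u q n))\<bar>
    \<le> (\<Sum>j = d..<n. surv_fun M X j (u n j))"
proof -
  let ?A = "A_event M X u q n"
  let ?W = "\<lambda>l. W_event M 0 l ?A"
  have W: "?W l \<in> events" for l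
    by (rule W_event_measurable[OF A_event_measurable])
  have sub: "?W n \<subseteq> ?W d"
    using assms by (auto simp: W_event_def)
  have "?W d - ?W n \<subseteq> (\<Union>j\<in>{d..<n}. ?A j)"
  proof
    fix y assume "y \<in> ?W d - ?W n"
    then obtain j where "j < n" "y \<in> ?A j" "\<not> j < d"
      by (auto simp: W_event_def split: if_splits)
    then show "y \<in> (\<Union>j\<in>{d..<n}. ?A j)"
      by auto
  qed
  then have "prob (?W d - ?W n) \<le> prob (\<Union>j\<in>{d..<n}. ?A j)"
    using A_event_measurable by (intro finite_measure_mono) auto
  also have "\<dots> \<le> (\<Sum>j = d..<n. prob (?A j))"
    using A_event_measurable by (intro finite_measure_subadditive_finite) auto
  also have "\<dots> \<le> (\<Sum>j = d..<n. surv_fun M X j (u n j))"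
    by (intro sum_mono prob_A_event_le)
  finally show ?thesis
    using finite_measure_Diff[OF W W sub] finite_measure_mono[OF sub W] by simp
qed

text \<open>The third claim is maximality: if one more index fits below \<open>n\<close>, including
  it must overshoot the target, and that index contributes at most \<open>Fbar_max\<close>.\<close>

lemma block_length_from_props:
  assumes "s \<le> n"
  shows "s + block_length_from M X u k n s \<le> n"
    and "(\<Sum>j = s..<s + block_length_from M X u k n s. surv_fun M X j (u n j))
      \<le> Fstar M X u n / real (k n)"
    and "s + block_length_from M X u k n s < n \<Longrightarrow>
      Fstar M X u n / real (k n) - Fbar_max M X u n
        \<le> (\<Sum>j = s..<s + block_length_from M X u k n s. surv_fun M X j (u n j))"
proof -
  let ?P = "\<lambda>l. s + l \<le> n \<and> (\<Sum>j = s..<s + l. surv_fun M X j (u n j)) \<le> Fstar M X u n / real (k n)"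
  let ?l = "block_length_from M X u k n s"
  \<comment> \<open>Together with the bound \<open>n\<close> on admissible lengths, this makes the
    \<open>GREATEST\<close> well defined.\<close>
  have "?P 0"
    using assms Fstar_nonneg by simp
  then have "?P ?l"
    unfolding block_length_from_def by (rule GreatestI_nat[where b = n]) simp
  then show "s + ?l \<le> n"
    and "(\<Sum>j = s..<s + ?l. surv_fun M X j (u n j)) \<le> Fstar M X u n / real (k n)"
    by auto
  assume less: "s + ?l < n"
  have "\<not> ?P (Suc ?l)"
  proof
    assume "?P (Suc ?l)"
    then have "Suc ?l \<le> ?l"
      unfolding block_length_from_def by (rule Greatest_le_nat[where b = n]) simp
    then show False by simp
  qed
  then show "Fstar M X u n / real (k n) - Fbar_max M X u n
      \<le> (\<Sum>j = s..<s + ?l. surv_fun M X j (u n j))"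
    using less surv_fun_le_Fbar_max[OF less, of u] by simp
qed

lemma block_end_le: "block_end M X u k n i \<le> n"
  by (induction i) (auto intro: block_length_from_props(1))

lemma mono_block_end: "mono (block_end M X u k n)"
  by (rule mono_iff_le_Suc[THEN iffD2]) simp

lemma block_sum_le:
  "(\<Sum>j = block_end M X u k n i..<block_end M X u k n (Suc i). surv_fun M X j (u n j))
    \<le> Fstar M X u n / real (k n)"
  using block_length_from_props(2)[OF block_end_le] by simp

text \<open>A block that does not reach \<open>n\<close> is within \<open>Fbar_max\<close> of the target \<open>Fstar / k\<close>.\<close>

lemma sum_after_blocks_le:
  assumes "0 < n" "0 < k n"
  shows "(\<Sum>j = block_end M X u k n (k n)..<n. surv_fun M X j (u n j)) \<le> k n * Fbar_max M X u n"
proof (cases "block_end M X u k n (k n) < n")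
  case True
  let ?b = "block_end M X u k n"
  let ?f = "\<lambda>j. surv_fun M X j (u n j)"
  have "real (k n) * (Fstar M X u n / real (k n) - Fbar_max M X u n)
      = (\<Sum>i<k n. Fstar M X u n / real (k n) - Fbar_max M X u n)"
    by simp
  also have "\<dots> \<le> (\<Sum>i<k n. \<Sum>j = ?b i..<?b (Suc i). ?f j)"
  proof (rule sum_mono)
    fix i assume "i \<in> {..<k n}"
    \<comment> \<open>The last block end is below \<open>n\<close> and ends are monotone, so no
      block reaches \<open>n\<close> and the lower bound holds for each of them.\<close>
    then have "?b (Suc i) \<le> ?b (k n)"
      by (intro monoD[OF mono_block_end]) auto
    then show "Fstar M X u n / real (k n) - Fbar_max M X u n \<le> (\<Sum>j = ?b i..<?b (Suc i). ?f j)"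
      using True block_length_from_props(3)[OF block_end_le, of u k n i] by simp
  qed
  also have "\<dots> = (\<Sum>j = 0..<?b (k n). ?f j)"
    by (simp add: sum_consecutive_blocks[OF mono_block_end] del: block_end.simps(2))
  also have "\<dots> = Fstar M X u n - (\<Sum>j = ?b (k n)..<n. ?f j)"
    unfolding Fstar_def using True
    by (simp add: sum.atLeastLessThan_concat[of 0 "?b (k n)" n ?f, symmetric])
  finally show ?thesis
    using \<open>0 < k n\<close> by (simp add: algebra_simps)
next
  case False
  then show ?thesis
    using assms Fbar_max_nonneg by simp
qed

end

section \<open>Passage to the limit\<close>

theorem theorem2p4:
  fixes M :: "(nat \<Rightarrow> 's) measure"
    and S :: "'s measure"
    and T :: "(nat \<Rightarrow> 's) \<Rightarrow> (nat \<Rightarrow> 's)"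
    and X :: "nat \<Rightarrow> (nat \<Rightarrow> 's) \<Rightarrow> real"
    and u :: "nat \<Rightarrow> nat \<Rightarrow> real"
    and \<tau> \<theta> :: real
    and q :: nat
    and tstar k :: "nat \<Rightarrow> nat"
  assumes "sequence_process M S T X"
    and "\<tau> > 0"
    and "(\<lambda>n. Fbar_max M X u n) \<longlonglongrightarrow> 0"
    and "(\<lambda>n. Fstar M X u n) \<longlonglongrightarrow> \<tau>"
    and "\<exists>j. returns_diverge M X u j"
    and "q = (LEAST j. returns_diverge M X u j)"
    and "cond_D M X u q tstar"
    and "cond_D' M X u q tstar k"
    and "0 \<le> \<theta>" and "\<theta> \<le> 1"
    and "(\<lambda>n. MAX i\<in>{1..k n}.
            \<bar>\<theta> * real (k n) *
               (\<Sum>j = block_end M X u k n (i - 1)..<block_end M X u k n i. surv_fun M X j (u n j))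
             - real (k n) *
               (\<Sum>j = block_end M X u k n (i - 1)..<block_end M X u k n i.
                  measure M (A_event M X u q n j))\<bar>) \<longlonglongrightarrow> 0"
  shows "(\<lambda>n. measure M {y \<in> space M. \<forall>i<n. X i y \<le> u n i}) \<longlonglongrightarrow> exp (- (\<theta> * \<tau>))"
proof -
  interpret sequence_process M S T X by fact
  define A where "A n = A_event M X u q n" for n
  define b where "b n = block_end M X u k n" for n
  define \<phi> where "\<phi> n = Fbar_max M X u n" for n
  define F where "F n = Fstar M X u n" for n
  define f where "f n j = surv_fun M X j (u n j)" for n j
  obtain \<gamma> :: "nat \<Rightarrow> nat \<Rightarrow> nat \<Rightarrow> real" where
    mix: "\<And>l t n i. l \<ge> 1 \<Longrightarrow> t \<ge> 1 \<Longrightarrow> n \<ge> 1 \<Longrightarrow>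
      \<bar>prob (A n i \<inter> W_event M (i + t) l (A n)) - prob (A n i) * prob (W_event M (i + t) l (A n))\<bar>
        \<le> \<gamma> i n t"
    and decr: "\<And>n i t t'. n \<ge> 1 \<Longrightarrow> t \<ge> 1 \<Longrightarrow> t \<le> t' \<Longrightarrow> \<gamma> i n t' \<le> \<gamma> i n t"
    and tpos: "\<And>n. n \<ge> 1 \<Longrightarrow> tstar n > 0"
    and \<gamma>_lim: "(\<lambda>n. \<Sum>i = 0..<n. \<gamma> i n (tstar n)) \<longlonglongrightarrow> 0"
    using \<open>cond_D M X u q tstar\<close> unfolding cond_D_def
    apply (elim exE conjE)
    subgoal for \<gamma> by (rule that[of \<gamma>]) (simp_all add: A_def)
    done
  define pairs where "pairs n = (\<Sum>i<k n. \<Sum>j = b n i..<b n (Suc i).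
      \<Sum>r = j + 1..<b n (Suc i). prob (A n j \<inter> A n r))" for n
  define block_dev where "block_dev n i = \<bar>\<theta> * real (k n) * (\<Sum>j = b n (i - 1)..<b n i. f n j)
      - real (k n) * (\<Sum>j = b n (i - 1)..<b n i. prob (A n j))\<bar>" for n i
  define dev where "dev n = (MAX i\<in>{1..k n}. block_dev n i)" for n
  define a where "a n = (\<Sum>j = 0..<b n (k n). prob (A n j))" for n
  have kpos: "\<And>n. n \<ge> 1 \<Longrightarrow> k n > 0" and k_lim: "filterlim k at_top sequentially"
    and kt\<phi>_lim: "(\<lambda>n. real (k n) * real (tstar n) * \<phi> n) \<longlonglongrightarrow> 0"
    using \<open>cond_D' M X u q tstar k\<close> by (auto simp: cond_D'_def \<phi>_def)
  \<comment> \<open>\<open>cond_D'\<close> numbers blocks from 1 and indices from the start of each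
    block, whereas \<open>pairs\<close> counts blocks from 0 and uses absolute indices.\<close>
  have pairs_lim: "pairs \<longlonglongrightarrow> 0"
  proof -
    have "pairs = (\<lambda>n. \<Sum>i = 1..k n. \<Sum>j = 0..<block_length M X u k n i.
        \<Sum>r = j + 1..<block_length M X u k n i.
          prob (A n (b n (i - 1) + j) \<inter> A n (b n (i - 1) + r)))"
      (is "_ = ?f")
    proof
      fix n
      have shift: "(\<Sum>j = s..<s + l. \<Sum>r = j + 1..<s + l. g j r)
          = (\<Sum>j = 0..<l. \<Sum>r = j + 1..<l. g (s + j) (s + r))"
        for s l :: nat and g :: "nat \<Rightarrow> nat \<Rightarrow> real"
      proof -
        have "(\<Sum>r = s + j + 1..<s + l. g (s + j) r) = (\<Sum>r = j + 1..<l. g (s + j) (s + r))" for j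
          using sum.shift_bounds_nat_ivl[of "g (s + j)" "j + 1" s l] by (simp add: ac_simps)
        moreover have "(\<Sum>j = s..<s + l. h j) = (\<Sum>j = 0..<l. h (s + j))" for h :: "nat \<Rightarrow> real"
          using sum.shift_bounds_nat_ivl[of h 0 s l] by (simp add: ac_simps)
        ultimately show ?thesis
          by simp
      qed
      show "pairs n = ?f n"
        unfolding pairs_def b_def sum.atLeast1_atMost_eq[folded One_nat_def]
        by (simp only: block_end.simps(2) shift block_length_def diff_Suc_1)
    qed
    then show ?thesis
      using \<open>cond_D' M X u q tstar k\<close> by (simp add: cond_D'_def A_def b_def)
  qed
  have dev_lim: "dev \<longlonglongrightarrow> 0"
    using assms(11) by (simp add: dev_def[abs_def] block_dev_def A_def b_def f_def)
  have \<phi>_lim: "\<phi> \<longlonglongrightarrow> 0" and F_lim: "F \<longlonglongrightarrow> \<tau>"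
    using assms(3,4) by (simp_all add: \<phi>_def[abs_def] F_def[abs_def])
  have A: "A n j \<in> events" for n j
    unfolding A_def by (rule A_event_measurable)
  have b_le: "b n i \<le> n" and b_mono: "mono (b n)" for n i
    unfolding b_def by (rule block_end_le mono_block_end)+
  have b_0: "b n 0 = 0" for n
    by (simp add: b_def)
  have A_le: "prob (A n j) \<le> f n j" for n j
    unfolding A_def f_def by (rule prob_A_event_le)
  have f_le: "j < n \<Longrightarrow> f n j \<le> \<phi> n" for n j
    unfolding f_def \<phi>_def by (rule surv_fun_le_Fbar_max)
  have \<phi>_nonneg: "n \<ge> 1 \<Longrightarrow> 0 \<le> \<phi> n" for n
    unfolding \<phi>_def by (rule Fbar_max_nonneg) simp
  \<comment> \<open>\<open>\<gamma>\<close> dominates an absolute value, here for the window of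
    length 1.\<close>
  have \<gamma>_nonneg: "0 \<le> \<gamma> i n (tstar n)" if "n \<ge> 1" for n i
    using mix[of 1 "tstar n" n i] tpos[OF that] that by auto

  \<comment> \<open>Since \<open>tstar n \<ge> 1\<close>, this sequence is dominated by the one with
    the factor \<open>tstar n\<close>.\<close>
  have k\<phi>_lim: "(\<lambda>n. real (k n) * \<phi> n) \<longlonglongrightarrow> 0"
  proof (rule tendsto_sandwich[OF _ _ tendsto_const kt\<phi>_lim])
    show "\<forall>\<^sub>F n in sequentially. 0 \<le> real (k n) * \<phi> n"
      using eventually_ge_at_top[of 1] by eventually_elim (simp add: \<phi>_nonneg)
    show "\<forall>\<^sub>F n in sequentially. real (k n) * \<phi> n \<le> real (k n) * real (tstar n) * \<phi> n"
      using eventually_ge_at_top[of 1]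
    proof eventually_elim
      case (elim n)
      then have "1 \<le> real (tstar n)"
        using tpos[of n] by simp
      then have "1 * (real (k n) * \<phi> n) \<le> real (tstar n) * (real (k n) * \<phi> n)"
        using elim \<phi>_nonneg by (intro mult_right_mono) auto
      then show ?case
        by (simp add: ac_simps)
    qed
  qed
  have rest_nonneg: "0 \<le> (\<Sum>j = b n (k n)..<n. f n j)" for n
    unfolding f_def by (intro sum_nonneg surv_fun_nonneg)
  have rest_le: "(\<Sum>j = b n (k n)..<n. f n j) \<le> real (k n) * \<phi> n" if "n \<ge> 1" for n
    unfolding f_def b_def \<phi>_def using kpos that by (intro sum_after_blocks_le) auto

  have a_lim: "a \<longlonglongrightarrow> \<theta> * \<tau>"
  proof -
    \<comment> \<open>The hypothesis on \<open>\<theta>\<close> carries a factor \<open>k n\<close>,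
      so each block deviates by at most \<open>dev n / k n\<close> and all \<open>k n\<close> blocks
      together by at most \<open>dev n\<close>.\<close>
    have blocks: "\<bar>\<theta> * (\<Sum>j = 0..<b n (k n). f n j) - a n\<bar> \<le> dev n" if "n \<ge> 1" for n
    proof -
      let ?d = "\<lambda>i. \<theta> * (\<Sum>j = b n i..<b n (Suc i). f n j) - (\<Sum>j = b n i..<b n (Suc i). prob (A n j))"
      have "\<theta> * (\<Sum>j = 0..<b n (k n). f n j) - a n = (\<Sum>i<k n. ?d i)"
        by (simp add: sum_subtractf sum_distrib_left[symmetric] sum_consecutive_blocks[OF b_mono]
            a_def b_0)
      then have "\<bar>\<theta> * (\<Sum>j = 0..<b n (k n). f n j) - a n\<bar> \<le> (\<Sum>i<k n. \<bar>?d i\<bar>)"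
        by (simp only: sum_abs)
      also have "\<dots> \<le> (\<Sum>i<k n. dev n / real (k n))"
      proof (rule sum_mono)
        fix i assume i: "i \<in> {..<k n}"
        have "block_dev n (Suc i) = \<bar>real (k n) * ?d i\<bar>"
          by (simp add: block_dev_def right_diff_distrib mult.left_commute mult.assoc)
        then have "real (k n) * \<bar>?d i\<bar> = block_dev n (Suc i)"
          by (simp add: abs_mult)
        also have "\<dots> \<le> dev n"
          unfolding dev_def using i by (intro Max_ge imageI) auto
        finally show "\<bar>?d i\<bar> \<le> dev n / real (k n)"
          using kpos[OF that] by (simp add: pos_le_divide_eq mult.commute)
      qed
      finally show ?thesis
        using kpos[OF that] by simp
    qed
    have F_split: "(\<Sum>j = 0..<b n (k n). f n j) = F n - (\<Sum>j = b n (k n)..<n. f n j)" for n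
      unfolding F_def Fstar_def f_def
      using sum.atLeastLessThan_concat[of 0 "b n (k n)" n "\<lambda>j. surv_fun M X j (u n j)"] b_le by simp
    have bound: "\<bar>\<theta> * F n - a n\<bar> \<le> dev n + \<theta> * (real (k n) * \<phi> n)" if "n \<ge> 1" for n
    proof -
      have "0 \<le> \<theta> * (\<Sum>j = b n (k n)..<n. f n j)"
        using rest_nonneg \<open>0 \<le> \<theta>\<close> by simp
      moreover have "\<theta> * (\<Sum>j = b n (k n)..<n. f n j) \<le> \<theta> * (real (k n) * \<phi> n)"
        using rest_le[OF that] \<open>0 \<le> \<theta>\<close> by (rule mult_left_mono)
      moreover have "\<bar>\<theta> * F n - \<theta> * (\<Sum>j = b n (k n)..<n. f n j) - a n\<bar> \<le> dev n"
        using blocks[OF that] unfolding F_split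
        by (simp add: right_diff_distrib)
      ultimately show ?thesis by linarith
    qed
    have "(\<lambda>n. dev n + \<theta> * (real (k n) * \<phi> n)) \<longlonglongrightarrow> 0 + \<theta> * 0"
      by (intro tendsto_intros dev_lim k\<phi>_lim)
    then have "(\<lambda>n. dev n + \<theta> * (real (k n) * \<phi> n)) \<longlonglongrightarrow> 0"
      by simp
    moreover have "\<forall>\<^sub>F n in sequentially. norm (\<theta> * F n - a n) \<le> dev n + \<theta> * (real (k n) * \<phi> n)"
      using eventually_ge_at_top[of 1] by eventually_elim (simp add: bound)
    ultimately have "(\<lambda>n. \<theta> * F n - a n) \<longlonglongrightarrow> 0"
      by (rule Lim_null_comparison[rotated])
    then have "(\<lambda>n. \<theta> * F n - (\<theta> * F n - a n)) \<longlonglongrightarrow> \<theta> * \<tau> - 0"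
      by (intro tendsto_intros F_lim)
    then show ?thesis by simp
  qed

  \<comment> \<open>In order: the last \<open>q\<close> indices, the indices after the last block,
    then the four errors of \<open>block_approximation\<close>. The last term bounds the squares:
    each block sum is at most \<open>F n / k n\<close>, and there are \<open>k n\<close> of
    them.\<close>
  define err where "err n = real q * \<phi> n + real (k n) * \<phi> n + ((\<Sum>i = 0..<n. \<gamma> i n (tstar n))
      + real (k n) * real (tstar n) * \<phi> n + pairs n + F n * (F n * inverse (real (k n))))" for n
  let ?p = "\<lambda>n. prob {y \<in> space M. \<forall>i<n. X i y \<le> u n i}"
  have err_lim: "err \<longlonglongrightarrow> 0"
  proof -
    have "(\<lambda>n. inverse (real (k n))) \<longlonglongrightarrow> 0"
      using k_lim by (intro tendsto_inverse_0_at_top filterlim_compose[OF filterlim_real_sequentially])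
    then have "err \<longlonglongrightarrow> real q * 0 + 0 + (0 + 0 + 0 + \<tau> * (\<tau> * 0))"
      unfolding err_def[abs_def]
      by (intro tendsto_intros \<phi>_lim k\<phi>_lim \<gamma>_lim kt\<phi>_lim pairs_lim F_lim)
    then show ?thesis by simp
  qed
  have "\<bar>?p n - exp (- a n)\<bar> \<le> err n" if "n \<ge> 1" for n
  proof -
    have "\<bar>?p n - prob (W_event M 0 n (A n))\<bar> \<le> real q * \<phi> n"
      unfolding A_def \<phi>_def using that by (intro no_exceedance_approx) simp
    moreover have "\<bar>prob (W_event M 0 n (A n)) - prob (W_event M 0 (b n (k n)) (A n))\<bar>
        \<le> real (k n) * \<phi> n"
      using prob_W_event_truncate[OF b_le[of n "k n"], of u q] rest_le[OF that]
      by (simp add: A_def f_def)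
    moreover have "\<bar>prob (W_event M 0 (b n (k n)) (A n)) - exp (- a n)\<bar>
        \<le> (\<Sum>j = 0..<b n (k n). \<gamma> j n (tstar n)) + real (k n) * (real (tstar n) * \<phi> n) + pairs n
          + (\<Sum>i<k n. (\<Sum>j = b n i..<b n (Suc i). prob (A n j))\<^sup>2)"
      unfolding a_def pairs_def
    proof (rule block_approximation[OF A b_mono b_0])
      show "prob (A n j) \<le> \<phi> n" if "j < b n (k n)" for j
        using A_le[of n j] f_le[of j n] b_le[of n "k n"] that by simp
      show "\<bar>prob (A n j \<inter> W_event M e (b n (k n) - e) (A n))
          - prob (A n j) * prob (W_event M e (b n (k n) - e) (A n))\<bar> \<le> \<gamma> j n (tstar n)"
        if "e \<le> b n (k n)" "j + tstar n \<le> e" for j e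
      \<comment> \<open>Condition \<open>D\<close> requires windows of positive length. For the
        empty window the difference vanishes.\<close>
      proof (cases "e = b n (k n)")
        case True
        have "A n j \<inter> space M = A n j"
          using sets.sets_into_space[OF A] by blast
        then show ?thesis
          using True \<gamma>_nonneg[OF \<open>n \<ge> 1\<close>] by (simp add: W_event_def prob_space)
      next
        case False
        have "1 \<le> tstar n"
          using tpos[OF \<open>n \<ge> 1\<close>] by simp
        \<comment> \<open>The window must start exactly at \<open>e\<close>, so \<open>D\<close> is
          applied with gap \<open>e - j\<close>, which is at least \<open>tstar n\<close>;
          monotonicity of \<open>\<gamma>\<close> in the gap does the rest.\<close>
        then have "\<gamma> j n (e - j) \<le> \<gamma> j n (tstar n)"
          using that by (intro decr \<open>n \<ge> 1\<close>) auto
        moreover have "\<bar>prob (A n j \<inter> W_event M e (b n (k n) - e) (A n))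
            - prob (A n j) * prob (W_event M e (b n (k n) - e) (A n))\<bar> \<le> \<gamma> j n (e - j)"
          using mix[of "b n (k n) - e" "e - j" n j] False that \<open>1 \<le> tstar n\<close> \<open>n \<ge> 1\<close> by simp
        ultimately show ?thesis by simp
      qed
    qed (use \<gamma>_nonneg \<phi>_nonneg that in auto)
    moreover have "(\<Sum>j = 0..<b n (k n). \<gamma> j n (tstar n)) \<le> (\<Sum>j = 0..<n. \<gamma> j n (tstar n))"
      using b_le \<gamma>_nonneg[OF that] by (intro sum_mono2) auto
    moreover have "(\<Sum>i<k n. (\<Sum>j = b n i..<b n (Suc i). prob (A n j))\<^sup>2)
        \<le> F n * (F n * inverse (real (k n)))"
    proof -
      have "(\<Sum>j = b n i..<b n (Suc i). prob (A n j)) \<le> F n / real (k n)" for i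
        using order_trans[OF sum_mono[OF A_le] block_sum_le[where u = u and k = k and n = n and i = i, folded b_def f_def F_def]]
        by simp
      then have "(\<Sum>i<k n. (\<Sum>j = b n i..<b n (Suc i). prob (A n j))\<^sup>2)
          \<le> (\<Sum>i<k n. (F n / real (k n))\<^sup>2)"
        by (intro sum_mono power_mono sum_nonneg) auto
      also have "\<dots> = F n * (F n * inverse (real (k n)))"
        using kpos[OF that] by (simp add: power2_eq_square field_simps)
      finally show ?thesis .
    qed
    ultimately show ?thesis
      by (simp add: err_def mult.assoc)
  qed
  then have "\<forall>\<^sub>F n in sequentially. norm (?p n - exp (- a n)) \<le> err n"
    unfolding real_norm_def by (rule eventually_sequentiallyI)
  then have "(\<lambda>n. ?p n - exp (- a n)) \<longlonglongrightarrow> 0"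
    using err_lim by (rule Lim_null_comparison)
  then have "(\<lambda>n. (?p n - exp (- a n)) + exp (- a n)) \<longlonglongrightarrow> 0 + exp (- (\<theta> * \<tau>))"
    by (intro tendsto_intros a_lim)
  then show ?thesis by simp
qed

end
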